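(* Let $\mathcal{M}$ be a compact smooth embedded submanifold of $\mathbb{R}^n$ and let $f$ be a real-valued function of class $C^2$ on an open neighbourhood of $\mathcal{M}$ in $\mathbb{R}^n$. Let $r>0$ be such that the orthogonal projection $P_{\mathcal{M}}$ is single-valued and smooth on the tube $\{y\in\mathbb{R}^n:\operatorname{dist}(y,\mathcal{M})<r\}$. For $x\in\mathcal{M}$ put $R_x[u]=P_{\mathcal{M}}(x+u)$, and assume that $R$ is Retraction L-smooth around $0$ with constant $L>0$, that is, $$\|DR_x[u]-DR_x[0]\|\le L\|u\|\qquad\text{for all }x\in\mathcal{M}\text{ and all }u\in T_x\mathcal{M}\text{ with }\|u\|<r.$$ Let $H=\max_{x\in\mathcal{M}}\|D\,\mathrm{grad} f(x)\|$ and $G=\max_{x\in\mathcal{M}}\|\mathrm{grad} f(x)\|$. If the step-size $\alpha>0$ satisfies $$\alpha<\min\left(\frac{1}{2H},\ \frac{1}{3LG},\ \frac{r}{G}\right),$$ then the Riemannian gradient descent map $$g:\mathcal{M}\to\mathcal{M},\qquad g(x)=P_{\mathcal{M}}\bigl(x-\alpha\,\mathrm{grad} f(x)\bigr),$$ is an immersion; equivalently, for every $x\in\mathcal{M}$ the differential $Dg(x):T_x\mathcal{M}\to T_{g(x)}\mathcal{M}$ satisfies $\det(Dg(x))\neq 0$.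
   Context: $\|\cdot\|$ is the Euclidean norm on vectors and the induced operator (spectral) norm on linear maps. The orthogonal projection onto $\mathcal{M}$ is $P_{\mathcal{M}}(y)=\operatorname{argmin}\{\|y-z\|: z\in\mathcal{M}\}$; for compact smooth $\mathcal{M}$ an $r>0$ as in the claim always exists. $T_x\mathcal{M}\subseteq\mathbb{R}^n$ is the tangent space at $x$ and $P_{T_x\mathcal{M}}$ the orthogonal projection of $\mathbb{R}^n$ onto it. The Riemannian gradient (for the metric induced from $\mathbb{R}^n$) is $\mathrm{grad} f(x)=P_{T_x\mathcal{M}}(\nabla f(x))$, with $\nabla f$ the Euclidean gradient. $D\,\mathrm{grad} f(x)$ denotes the directional derivative of the $\mathbb{R}^n$-valued map $x\mapsto \mathrm{grad} f(x)$ on $\mathcal{M}$ along tangent directions, i.e. a linear map $T_x\mathcal{M}\to\mathbb{R}^n$, and its norm is the operator norm of this map. $DR_x[u]$ denotes the Euclidean derivative of $v\mapsto P_{\mathcal{M}}(x+v)$ at $v=u$, with $x$ held fixed, viewed as a linear map $\mathbb{R}^n\to\mathbb{R}^n$; that is, $DR_x[u]=DP_{\mathcal{M}}(x+u)$. The condition $\det(Dg(x))\ne 0$ refers to the matrix of $Dg(x)$ with respect to arbitrary bases of $T_x\mathcal{M}$ and $T_{g(x)}\mathcal{M}$ (its non-vanishing does not depend on the bases). If $H=0$ or $G=0$, the fractions with zero denominator are read as $+\infty$. *)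

theory Defs
  imports "HOL-Analysis.Analysis" "Jordan_Normal_Form.Determinant"
begin

text \<open>
  \<open>Ck_on k f S\<close> is the class \<open>C\<^sup>k\<close> on an \<^emph>\<open>open\<close> set \<open>S\<close> of a finite-dimensional space: all iterated
  directional derivatives up to order \<open>k\<close> exist and are continuous on \<open>S\<close>.
\<close>

primrec Ck_on ::
  "nat \<Rightarrow> ('a::euclidean_space \<Rightarrow> 'b::real_normed_vector) \<Rightarrow> 'a set \<Rightarrow> bool" where
  "Ck_on 0 f S \<longleftrightarrow> continuous_on S f"
| "Ck_on (Suc k) f S \<longleftrightarrow>
     (\<forall>x\<in>S. f differentiable (at x)) \<and>
     (\<forall>v. Ck_on k (\<lambda>x. frechet_derivative f (at x) v) S)"

definition smooth_on :: "('a::euclidean_space \<Rightarrow> 'b::real_normed_vector) \<Rightarrow> 'a set \<Rightarrow> bool" where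
  "smooth_on f S \<longleftrightarrow> (\<forall>k. Ck_on k f S)"

text \<open>Embedded \<open>d\<close>-dimensional submanifolds (without boundary), by smooth slice charts of the ambient space.\<close>

definition smooth_submanifold :: "nat \<Rightarrow> 'a::euclidean_space set \<Rightarrow> bool" where
  "smooth_submanifold d M \<longleftrightarrow>
     (\<forall>x\<in>M. \<exists>U V \<phi> \<psi> S.
        open U \<and> x \<in> U \<and> open (V :: 'a set) \<and> homeomorphism U V \<phi> \<psi> \<and>
        smooth_on \<phi> U \<and> smooth_on \<psi> V \<and>
        subspace S \<and> dim S = d \<and> \<phi> ` (U \<inter> M) = V \<inter> S)"

definition curve_with_velocity ::
  "'a::euclidean_space set \<Rightarrow> 'a \<Rightarrow> 'a \<Rightarrow> (real \<Rightarrow> 'a) \<Rightarrow> bool" where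
  "curve_with_velocity M x v \<gamma> \<longleftrightarrow>
     (\<exists>\<epsilon>>0. smooth_on \<gamma> {-\<epsilon><..<\<epsilon>} \<and> \<gamma> ` {-\<epsilon><..<\<epsilon>} \<subseteq> M) \<and>
     \<gamma> 0 = x \<and> (\<gamma> has_vector_derivative v) (at 0)"

definition tangent_space :: "'a::euclidean_space set \<Rightarrow> 'a \<Rightarrow> 'a set" where
  "tangent_space M x = {v. \<exists>\<gamma>. curve_with_velocity M x v \<gamma>}"

text \<open>
  The differential at \<open>x\<close> of a map \<open>F\<close> on \<open>M\<close>, in the direction \<open>v \<in> tangent_space M x\<close>: the common
  derivative at \<open>0\<close> of \<open>F \<circ> \<gamma>\<close> over all curves \<open>\<gamma>\<close> in \<open>M\<close> through \<open>x\<close> with velocity \<open>v\<close>.  Only the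
  values of \<open>F\<close> on \<open>M\<close> matter, and the value for \<open>v\<close> outside the tangent space is unspecified.
\<close>

definition differential ::
  "'a::euclidean_space set \<Rightarrow> ('a \<Rightarrow> 'b::real_normed_vector) \<Rightarrow> 'a \<Rightarrow> 'a \<Rightarrow> 'b" where
  "differential M F x v =
     (THE w. \<forall>\<gamma>. curve_with_velocity M x v \<gamma> \<longrightarrow> ((F \<circ> \<gamma>) has_vector_derivative w) (at 0))"

text \<open>Operator norm of a linear map defined only on a subspace \<open>S\<close>; \<open>onorm\<close> is the case \<open>S = UNIV\<close>.\<close>

definition onorm_on ::
  "'a::real_normed_vector set \<Rightarrow> ('a \<Rightarrow> 'b::real_normed_vector) \<Rightarrow> real" where
  "onorm_on S A = (SUP v\<in>S. norm (A v) / norm v)"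

definition gradient :: "('a::euclidean_space \<Rightarrow> real) \<Rightarrow> 'a \<Rightarrow> 'a" where
  "gradient f x = (THE D. GDERIV f x :> D)"

text \<open>On a subspace, \<open>closest_point\<close> is the orthogonal projection onto it.\<close>

definition riemannian_gradient ::
  "'a::euclidean_space set \<Rightarrow> ('a \<Rightarrow> real) \<Rightarrow> 'a \<Rightarrow> 'a" where
  "riemannian_gradient M f x = closest_point (tangent_space M x) (gradient f x)"

definition tube :: "'a::euclidean_space set \<Rightarrow> real \<Rightarrow> 'a set" where
  "tube M r = {y. infdist y M < r}"

text \<open>
  The point minimising the distance to \<open>y\<close> over \<open>M\<close> exists and is unique, so that \<open>closest_point M y\<close>
  is this point rather than a choice among several.
\<close>

definition single_valued_projection :: "'a::euclidean_space set \<Rightarrow> 'a \<Rightarrow> bool" where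
  "single_valued_projection M y \<longleftrightarrow> (\<exists>!z. z \<in> M \<and> (\<forall>w\<in>M. dist y z \<le> dist y w))"

definition proj_retraction :: "'a::euclidean_space set \<Rightarrow> 'a \<Rightarrow> 'a \<Rightarrow> 'a" where
  "proj_retraction M x u = closest_point M (x + u)"

definition retraction_deriv :: "'a::euclidean_space set \<Rightarrow> 'a \<Rightarrow> 'a \<Rightarrow> 'a \<Rightarrow> 'a" where
  "retraction_deriv M x u = frechet_derivative (proj_retraction M x) (at u)"

definition retraction_L_smooth :: "'a::euclidean_space set \<Rightarrow> real \<Rightarrow> real \<Rightarrow> bool" where
  "retraction_L_smooth M r L \<longleftrightarrow>
     (\<forall>x\<in>M. \<forall>u\<in>tangent_space M x. norm u < r \<longrightarrow>
        onorm (\<lambda>w. retraction_deriv M x u w - retraction_deriv M x 0 w) \<le> L * norm u)"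

definition rgd_map :: "'a::euclidean_space set \<Rightarrow> ('a \<Rightarrow> real) \<Rightarrow> real \<Rightarrow> 'a \<Rightarrow> 'a" where
  "rgd_map M f \<alpha> x = closest_point M (x - \<alpha> *\<^sub>R riemannian_gradient M f x)"

text \<open>\<open>C\<^sup>k\<close> maps on a subset: those with local \<open>C\<^sup>k\<close> extensions to open subsets of the ambient space.\<close>

definition Ck_map ::
  "nat \<Rightarrow> 'a::euclidean_space set \<Rightarrow> ('a \<Rightarrow> 'b::real_normed_vector) \<Rightarrow> bool" where
  "Ck_map k M F \<longleftrightarrow>
     (\<forall>x\<in>M. \<exists>U E. open U \<and> x \<in> U \<and> Ck_on k E U \<and> (\<forall>y\<in>U \<inter> M. E y = F y))"

text \<open>
  Immersions of class \<open>C\<^sup>1\<close> between embedded submanifolds; for \<open>f\<close> of class \<open>C\<^sup>2\<close> the gradient descent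
  map is in general no smoother than that.
\<close>

definition immersion ::
  "'a::euclidean_space set \<Rightarrow> 'b::euclidean_space set \<Rightarrow> ('a \<Rightarrow> 'b) \<Rightarrow> bool" where
  "immersion M N g \<longleftrightarrow>
     g ` M \<subseteq> N \<and> Ck_map 1 M g \<and> (\<forall>x\<in>M. inj_on (differential M g x) (tangent_space M x))"

definition ordered_basis :: "'a::real_vector set \<Rightarrow> 'a list \<Rightarrow> bool" where
  "ordered_basis S bs \<longleftrightarrow> distinct bs \<and> independent (set bs) \<and> span (set bs) = S"

text \<open>
  The matrix of \<open>A : span bs \<rightarrow> span cs\<close> with respect to the ordered bases \<open>bs\<close> and \<open>cs\<close>.  The matrix
  size is not a type here, so that zero-dimensional manifolds are covered.
\<close>

definition matrix_wrt ::
  "'a::real_vector list \<Rightarrow> 'b::real_vector list \<Rightarrow> ('a \<Rightarrow> 'b) \<Rightarrow> real Matrix.mat" where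
  "matrix_wrt bs cs A =
     Matrix.mat (length cs) (length bs)
       (\<lambda>(i, j). representation (set cs) (A (bs ! j)) (cs ! i))"

end

theory Submission
  imports Defs
begin

text \<open>
  Write \<open>P\<close> for the nearest-point projection onto \<open>M\<close> and \<open>DP y\<close> for its derivative at \<open>y\<close>.  At a
  point \<open>x\<close> of \<open>M\<close> the map \<open>DP x\<close> is the orthogonal projection onto the tangent space at \<open>x\<close>: it is
  idempotent with the tangent space as its range because \<open>P\<close> is a retraction onto \<open>M\<close>, and it is
  orthogonal because \<open>y - P y\<close> is normal to \<open>M\<close> at \<open>P y\<close> (\<open>DP_orthogonal\<close>).

  Hence the Riemannian gradient extends to the map \<open>E y = DP y (gradient f y)\<close> of class C-1 near \<open>M\<close>
  (\<open>riemannian_gradient_extension\<close>).  Both this gradient and the operator norm of its differential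
  are therefore continuous on the compact set \<open>M\<close>, and \<open>G\<close> and \<open>H\<close> bound them.

  Put \<open>u = - \<alpha> E x\<close>, a tangent vector of norm at most \<open>\<alpha> G < r\<close>.  By the chain rule
  the descent map \<open>g\<close> has the differential \<open>Dg v = DP (x + u) (v - \<alpha> DE v)\<close> at \<open>x\<close>.  By the
  smoothness hypothesis on the retraction, \<open>DP (x + u)\<close> differs from \<open>DP x\<close> by at most
  \<open>L \<alpha> G < 1/3\<close> in operator norm, and \<open>\<alpha> DE v\<close> has norm at most \<open>\<alpha> H\<close> times that of \<open>v\<close>, where
  \<open>\<alpha> H < 1/2\<close>.  Since \<open>DP x\<close> fixes \<open>v\<close> and does not increase norms, \<open>Dg v\<close> differs from \<open>v\<close> by
  less than \<open>1/3 + (1 + 1/3) / 2 = 1\<close> times the norm of \<open>v\<close>, unless \<open>v = 0\<close>.  So \<open>Dg\<close> is injective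
  (\<open>perturbed_projection_injective\<close>).  All tangent spaces have the dimension of the slice charts
  (\<open>dim_tangent_space_submanifold\<close>), so the matrix of \<open>Dg\<close> in any bases is square, and its
  determinant does not vanish (\<open>det_matrix_wrt_nonzero\<close>).
\<close>

no_notation scalar_prod (infix "\<bullet>" 70)


section \<open>Maps of class C-k\<close>

lemma Ck_on_cong:
  assumes "open S" "\<And>x. x \<in> S \<Longrightarrow> f x = g x" "Ck_on k f S"
  shows "Ck_on k g S"
  using assms
proof (induction k arbitrary: f g)
  case 0
  then show ?case using continuous_on_cong by force
next
  case (Suc k)
  have g: "(g has_derivative frechet_derivative f (at x)) (at x)" if "x \<in> S" for x
    using Suc.prems that
    by (intro has_derivative_transform_within_open[of f _ x UNIV S g])
      (auto simp: frechet_derivative_works)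
  have eq: "frechet_derivative f (at x) v = frechet_derivative g (at x) v" if "x \<in> S" for x v
    using frechet_derivative_at[OF g[OF that]] by simp
  have "Ck_on k (\<lambda>x. frechet_derivative g (at x) v) S" for v
    by (rule Suc.IH[OF Suc.prems(1) eq]) (use Suc.prems in auto)
  then show ?case
    using g by (auto simp: differentiable_def)
qed

lemma Ck_on_compose_line:
  fixes f :: "'a::euclidean_space \<Rightarrow> 'b::real_normed_vector" and J :: "real set"
  assumes "open J" "\<And>t. t \<in> J \<Longrightarrow> a + t *\<^sub>R v \<in> S" "Ck_on k f S"
  shows "Ck_on k (\<lambda>t. f (a + t *\<^sub>R v)) J"
  using assms
proof (induction k arbitrary: f)
  case 0
  then show ?case
    by (auto intro!: continuous_on_compose2[of S f] continuous_intros)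
next
  case (Suc k)
  have d: "((\<lambda>t. f (a + t *\<^sub>R v)) has_derivative
      (\<lambda>h. frechet_derivative f (at (a + t *\<^sub>R v)) (h *\<^sub>R v))) (at t)" if "t \<in> J" for t
  proof (rule has_derivative_compose[of "\<lambda>t. a + t *\<^sub>R v" "\<lambda>h. h *\<^sub>R v"])
    show "((\<lambda>t. a + t *\<^sub>R v) has_derivative (\<lambda>h. h *\<^sub>R v)) (at t)"
      by (auto intro!: derivative_eq_intros)
    show "(f has_derivative frechet_derivative f (at (a + t *\<^sub>R v))) (at (a + t *\<^sub>R v))"
      using Suc.prems that by (auto simp: frechet_derivative_works)
  qed
  have "Ck_on k (\<lambda>t. frechet_derivative (\<lambda>t. f (a + t *\<^sub>R v)) (at t) h) J" for h
  proof (rule Ck_on_cong[OF Suc.prems(1)])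
    show "Ck_on k (\<lambda>t. frechet_derivative f (at (a + t *\<^sub>R v)) (h *\<^sub>R v)) J"
      by (rule Suc.IH) (use Suc.prems in auto)
    show "frechet_derivative f (at (a + t *\<^sub>R v)) (h *\<^sub>R v)
        = frechet_derivative (\<lambda>t. f (a + t *\<^sub>R v)) (at t) h" if "t \<in> J" for t
      using frechet_derivative_at[OF d[OF that]] by metis
  qed
  then show ?case
    using d by (auto simp: differentiable_def)
qed

lemma smooth_on_differentiable: "smooth_on f S \<Longrightarrow> x \<in> S \<Longrightarrow> f differentiable (at x)"
  unfolding smooth_on_def using Ck_on.simps(2) by blast

lemma smooth_on_frechet_derivative:
  "smooth_on f S \<Longrightarrow> smooth_on (\<lambda>x. frechet_derivative f (at x) v) S"
  unfolding smooth_on_def using Ck_on.simps(2) by blast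

text \<open>Along a straight line through a point of an open set, a smooth map traces a curve whose
  velocity is the directional derivative.  All tangent vectors exhibited
  below are velocities of such curves.\<close>

lemma curve_with_velocity_along_line:
  fixes f :: "'a::euclidean_space \<Rightarrow> 'b::euclidean_space"
  assumes "open S" "a \<in> S" "smooth_on f S" "\<And>t. a + t *\<^sub>R v \<in> S \<Longrightarrow> f (a + t *\<^sub>R v) \<in> M"
  shows "curve_with_velocity M (f a) (frechet_derivative f (at a) v) (\<lambda>t. f (a + t *\<^sub>R v))"
proof -
  have "open ((\<lambda>t. a + t *\<^sub>R v) -` S)"
    using \<open>open S\<close> by (intro continuous_open_vimage) (auto intro!: continuous_intros)
  moreover have "0 \<in> (\<lambda>t. a + t *\<^sub>R v) -` S"
    using \<open>a \<in> S\<close> by simp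
  ultimately obtain \<epsilon> where e: "\<epsilon> > 0" "ball 0 \<epsilon> \<subseteq> (\<lambda>t. a + t *\<^sub>R v) -` S"
    using open_contains_ball by meson
  have J: "a + t *\<^sub>R v \<in> S" if "t \<in> {-\<epsilon><..<\<epsilon>}" for t
    using e(2) that by (auto simp: subset_iff)
  have "((\<lambda>t. f (a + t *\<^sub>R v)) has_derivative
      (\<lambda>h. frechet_derivative f (at a) (h *\<^sub>R v))) (at 0)"
  proof (rule has_derivative_compose[of "\<lambda>t. a + t *\<^sub>R v" "\<lambda>h. h *\<^sub>R v"])
    show "((\<lambda>t. a + t *\<^sub>R v) has_derivative (\<lambda>h. h *\<^sub>R v)) (at 0)"
      by (auto intro!: derivative_eq_intros)
    show "(f has_derivative frechet_derivative f (at a)) (at (a + 0 *\<^sub>R v))"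
      using smooth_on_differentiable[OF assms(3,2)] by (simp add: frechet_derivative_works)
  qed
  moreover have "frechet_derivative f (at a) (h *\<^sub>R v) = h *\<^sub>R frechet_derivative f (at a) v" for h
    using smooth_on_differentiable[OF assms(3,2)] linear_frechet_derivative linear_cmul by blast
  ultimately have "((\<lambda>t. f (a + t *\<^sub>R v)) has_vector_derivative frechet_derivative f (at a) v) (at 0)"
    by (simp add: has_vector_derivative_def)
  moreover have "smooth_on (\<lambda>t. f (a + t *\<^sub>R v)) {-\<epsilon><..<\<epsilon>}"
    using assms(3) J by (auto simp: smooth_on_def intro!: Ck_on_compose_line[of _ a v S])
  ultimately show ?thesis
    unfolding curve_with_velocity_def using e(1) J assms(4) by (auto intro!: exI[of _ \<epsilon>])
qed

lemma Ck_on_1_iff: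
  "Ck_on 1 f S \<longleftrightarrow> (\<forall>x\<in>S. f differentiable (at x)) \<and>
     (\<forall>v. continuous_on S (\<lambda>x. frechet_derivative f (at x) v))"
  by (simp add: One_nat_def)

lemma Ck_on_1I:
  assumes "\<And>x. x \<in> S \<Longrightarrow> (f has_derivative f' x) (at x)"
    and "\<And>v. continuous_on S (\<lambda>x. f' x v)"
  shows "Ck_on 1 f S"
proof -
  have "frechet_derivative f (at x) = f' x" if "x \<in> S" for x
    using frechet_derivative_at[OF assms(1)[OF that]] by simp
  then have "continuous_on S (\<lambda>x. frechet_derivative f (at x) v)" for v
    using assms(2)[of v] by (simp cong: continuous_on_cong)
  then show ?thesis
    using assms(1) by (auto simp only: Ck_on_1_iff differentiable_def)
qed

lemma Ck_on_1_has_derivative: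
  "Ck_on 1 f S \<Longrightarrow> x \<in> S \<Longrightarrow> (f has_derivative frechet_derivative f (at x)) (at x)"
  by (simp only: Ck_on_1_iff frechet_derivative_works)

lemma Ck_on_1_continuous_derivative:
  "Ck_on 1 f S \<Longrightarrow> continuous_on S (\<lambda>x. frechet_derivative f (at x) v)"
  by (simp only: Ck_on_1_iff)

lemma Ck_on_1_continuous: "Ck_on 1 f S \<Longrightarrow> continuous_on S f"
  by (meson Ck_on_1_has_derivative has_derivative_continuous continuous_at_imp_continuous_on)

lemma smooth_on_Ck_on_1: "smooth_on f S \<Longrightarrow> Ck_on 1 f S"
  unfolding smooth_on_def by blast

lemma linear_eq_sum_Basis:
  fixes A :: "'a::euclidean_space \<Rightarrow> 'b::real_vector"
  assumes "linear A"
  shows "A w = (\<Sum>b\<in>Basis. (w \<bullet> b) *\<^sub>R A b)"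
proof -
  have "A w = A (\<Sum>b\<in>Basis. (w \<bullet> b) *\<^sub>R b)"
    by (simp add: euclidean_representation)
  then show ?thesis
    using assms by (simp add: linear_sum linear_cmul)
qed

text \<open>Continuity of each directional derivative already gives continuity in the point and the
  direction together, because the derivative is determined by its values on a finite basis.\<close>

lemma Ck_on_1_continuous_derivative_apply:
  assumes f: "Ck_on 1 f S" and "continuous_on T g" "g ` T \<subseteq> S" "continuous_on T h"
  shows "continuous_on T (\<lambda>x. frechet_derivative f (at (g x)) (h x))"
proof -
  have *: "continuous_on T (\<lambda>x. frechet_derivative f (at (g x)) b)" for b
    by (rule continuous_on_compose2[OF Ck_on_1_continuous_derivative[OF f] assms(2,3)])
  have "continuous_on T (\<lambda>x. \<Sum>b\<in>Basis. (h x \<bullet> b) *\<^sub>R frechet_derivative f (at (g x)) b)"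
    by (intro continuous_intros * assms)
  moreover have "frechet_derivative f (at (g x)) (h x)
      = (\<Sum>b\<in>Basis. (h x \<bullet> b) *\<^sub>R frechet_derivative f (at (g x)) b)" if "x \<in> T" for x
    using Ck_on_1_has_derivative[OF f] assms(3) that
    by (intro linear_eq_sum_Basis has_derivative_linear) blast
  ultimately show ?thesis
    by (simp cong: continuous_on_cong)
qed

lemma Ck_on_1_compose:
  assumes f: "Ck_on 1 f S" and g: "Ck_on 1 g T" and "g ` T \<subseteq> S"
  shows "Ck_on 1 (\<lambda>x. f (g x)) T"
proof (rule Ck_on_1I)
  show "((\<lambda>x. f (g x)) has_derivative
      (\<lambda>v. frechet_derivative f (at (g x)) (frechet_derivative g (at x) v))) (at x)" if "x \<in> T" for x
    by (rule has_derivative_compose[OF Ck_on_1_has_derivative[OF g that] Ck_on_1_has_derivative[OF f]])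
      (use that assms(3) in blast)
  show "continuous_on T (\<lambda>x. frechet_derivative f (at (g x)) (frechet_derivative g (at x) v))" for v
    by (intro Ck_on_1_continuous_derivative_apply[OF f Ck_on_1_continuous[OF g] assms(3)]
        Ck_on_1_continuous_derivative[OF g])
qed

lemma Ck_on_1_scaleR:
  assumes f: "Ck_on 1 f S" and g: "Ck_on 1 g S"
  shows "Ck_on 1 (\<lambda>x. f x *\<^sub>R g x) S"
proof (rule Ck_on_1I)
  show "((\<lambda>x. f x *\<^sub>R g x) has_derivative
      (\<lambda>v. f x *\<^sub>R frechet_derivative g (at x) v + frechet_derivative f (at x) v *\<^sub>R g x)) (at x)"
    if "x \<in> S" for x
    by (intro has_derivative_scaleR Ck_on_1_has_derivative[OF f that] Ck_on_1_has_derivative[OF g that])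
  show "continuous_on S (\<lambda>x. f x *\<^sub>R frechet_derivative g (at x) v + frechet_derivative f (at x) v *\<^sub>R g x)"
    for v
    by (intro continuous_intros Ck_on_1_continuous[OF f] Ck_on_1_continuous[OF g]
        Ck_on_1_continuous_derivative[OF f] Ck_on_1_continuous_derivative[OF g])
qed

lemma Ck_on_1_sum:
  assumes "\<And>i. i \<in> I \<Longrightarrow> Ck_on 1 (f i) S"
  shows "Ck_on 1 (\<lambda>x. \<Sum>i\<in>I. f i x) S"
proof (rule Ck_on_1I)
  show "((\<lambda>x. \<Sum>i\<in>I. f i x) has_derivative
      (\<lambda>v. \<Sum>i\<in>I. frechet_derivative (f i) (at x) v)) (at x)" if "x \<in> S" for x
    by (intro has_derivative_sum Ck_on_1_has_derivative[OF assms that])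
  show "continuous_on S (\<lambda>x. \<Sum>i\<in>I. frechet_derivative (f i) (at x) v)" for v
    by (intro continuous_intros Ck_on_1_continuous_derivative assms)
qed

lemma Ck_on_1_diff_scaleR:
  assumes f: "Ck_on 1 f S"
  shows "Ck_on 1 (\<lambda>x. x - c *\<^sub>R f x) S"
proof (rule Ck_on_1I)
  show "((\<lambda>x. x - c *\<^sub>R f x) has_derivative (\<lambda>v. v - c *\<^sub>R frechet_derivative f (at x) v)) (at x)"
    if "x \<in> S" for x
    by (intro derivative_intros Ck_on_1_has_derivative[OF f that])
  show "continuous_on S (\<lambda>x. v - c *\<^sub>R frechet_derivative f (at x) v)" for v
    by (intro continuous_intros Ck_on_1_continuous_derivative[OF f])
qed

lemma Ck_on_subset: "Ck_on k f S \<Longrightarrow> T \<subseteq> S \<Longrightarrow> Ck_on k f T"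
  by (induction k arbitrary: f) (simp add: continuous_on_subset, simp, blast)


section \<open>Tangent spaces and differentials\<close>

text \<open>A local extension of a map to the ambient space computes its differential, since the curves
  defining the differential stay in the manifold near the base point.\<close>

lemma differential_eq_extension:
  assumes E: "(E has_derivative E') (at x)" and "\<And>y. y \<in> M \<Longrightarrow> E y = F y"
    and v: "v \<in> tangent_space M x"
  shows "differential M F x v = E' v"
proof -
  have *: "((F \<circ> \<gamma>) has_vector_derivative E' v) (at 0)" if c: "curve_with_velocity M x v \<gamma>" for \<gamma>
  proof -
    from c obtain \<epsilon> where e: "\<epsilon> > 0" "\<gamma> ` {-\<epsilon><..<\<epsilon>} \<subseteq> M" and g: "\<gamma> 0 = x"
      "(\<gamma> has_vector_derivative v) (at 0)"
      unfolding curve_with_velocity_def by blast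
    have "((\<lambda>t. E (\<gamma> t)) has_derivative (\<lambda>h. E' (h *\<^sub>R v))) (at 0)"
      by (rule has_derivative_compose[OF g(2)[unfolded has_vector_derivative_def]])
        (simp add: g(1) E)
    then have d: "((\<lambda>t. E (\<gamma> t)) has_vector_derivative E' v) (at 0)"
      by (simp add: has_vector_derivative_def linear_cmul[OF has_derivative_linear[OF E]])
    have "E (\<gamma> t) = (F \<circ> \<gamma>) t" if "t \<in> {-\<epsilon><..<\<epsilon>}" for t
      using e(2) that by (simp add: assms(2) image_subset_iff)
    then show ?thesis
      by (rule has_vector_derivative_transform_within_open[OF d open_greaterThanLessThan, rotated])
        (use e(1) in auto)
  qed
  obtain \<gamma> where "curve_with_velocity M x v \<gamma>"
    using v by (auto simp: tangent_space_def)
  with * show ?thesis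
    unfolding differential_def
    by (intro the_equality allI impI *) (auto intro: vector_derivative_unique_at)
qed

lemma derivative_left_inverse:
  assumes "open U" "x \<in> U" "(\<phi> has_derivative A) (at x)" "(\<psi> has_derivative B) (at (\<phi> x))"
    and "\<And>y. y \<in> U \<Longrightarrow> \<psi> (\<phi> y) = y"
  shows "B (A v) = v"
proof -
  have 1: "((\<lambda>y. \<psi> (\<phi> y)) has_derivative (\<lambda>v. B (A v))) (at x)"
    by (rule has_derivative_compose[OF assms(3,4)])
  have 2: "((\<lambda>y. \<psi> (\<phi> y)) has_derivative (\<lambda>v. v)) (at x)"
    by (rule has_derivative_transform_within_open[OF has_derivative_ident assms(1,2)])
      (simp add: assms(5))
  show ?thesis
    using fun_cong[OF has_derivative_unique[OF 1 2], of v] .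
qed


text \<open>A slice chart carries tangent vectors isomorphically onto the model subspace: a curve in the
  manifold has its chart image in the subspace, and a line in the subspace is carried back to a
  curve in the manifold.\<close>

lemma dim_tangent_space_submanifold:
  fixes M :: "'a::euclidean_space set"
  assumes M: "smooth_submanifold d M" and "x \<in> M"
  shows "dim (tangent_space M x) = d"
proof -
  from M \<open>x \<in> M\<close> obtain U V \<phi> \<psi> S where
    c: "open U" "x \<in> U" "open (V :: 'a set)" "homeomorphism U V \<phi> \<psi>"
      "smooth_on \<phi> U" "smooth_on \<psi> V" "subspace S" "dim S = d" "\<phi> ` (U \<inter> M) = V \<inter> S"
    unfolding smooth_submanifold_def by meson
  define A where "A = frechet_derivative \<phi> (at x)"
  define B where "B = frechet_derivative \<psi> (at (\<phi> x))"
  have x: "\<phi> x \<in> V" "\<phi> x \<in> S" "\<psi> (\<phi> x) = x"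
    using c \<open>x \<in> M\<close> by (auto simp: homeomorphism_def)
  have A: "(\<phi> has_derivative A) (at x)"
    using smooth_on_differentiable[OF c(5,2)] by (simp add: A_def frechet_derivative_works)
  have B: "(\<psi> has_derivative B) (at (\<phi> x))"
    using smooth_on_differentiable[OF c(6) x(1)] by (simp add: B_def frechet_derivative_works)
  have BA: "B (A v) = v" for v
    by (rule derivative_left_inverse[OF c(1,2) A B]) (use c(4) in \<open>simp add: homeomorphism_def\<close>)
  have "(\<phi> has_derivative A) (at (\<psi> (\<phi> x)))"
    using A by (simp only: x(3))
  then have AB: "A (B v) = v" for v
    by (rule derivative_left_inverse[OF c(3) x(1) B]) (use c(4) in \<open>simp add: homeomorphism_def\<close>)
  have A_S: "A v \<in> S" if "v \<in> tangent_space M x" for v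
  proof -
    from that obtain \<gamma> \<epsilon> where g: "\<epsilon> > 0" "\<gamma> ` {-\<epsilon><..<\<epsilon>} \<subseteq> M" "\<gamma> 0 = x"
      "(\<gamma> has_vector_derivative v) (at 0)"
      unfolding tangent_space_def curve_with_velocity_def by blast
    have "((\<lambda>t. \<phi> (\<gamma> t)) has_derivative (\<lambda>h. A (h *\<^sub>R v))) (at 0)"
      by (rule has_derivative_compose[OF g(4)[unfolded has_vector_derivative_def]])
        (simp add: g(3) A)
    then have d: "((\<lambda>t. \<phi> (\<gamma> t)) has_vector_derivative A v) (at 0)"
      by (simp add: has_vector_derivative_def linear_cmul[OF has_derivative_linear[OF A]])
    \<comment> \<open>Pairing with a vector normal to \<open>S\<close> gives a function that vanishes near \<open>0\<close>.\<close>
    have "n \<bullet> A v = 0" if n: "n \<in> S\<^sup>\<bottom>" for n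
    proof -
      have "isCont \<gamma> 0"
        using g(4) has_vector_derivative_continuous by blast
      then have "(\<gamma> \<longlongrightarrow> \<gamma> 0) (nhds 0)"
        by (simp only: isCont_def tendsto_at_iff_tendsto_nhds)
      then have "\<forall>\<^sub>F t in nhds 0. \<gamma> t \<in> U"
        by (rule topological_tendstoD) (simp_all add: c(1,2) g(3))
      moreover have "\<forall>\<^sub>F t in nhds 0. t \<in> {-\<epsilon><..<\<epsilon>}"
        using g(1) by (intro eventually_nhds_in_open) auto
      ultimately have "\<forall>\<^sub>F t in nhds 0. n \<bullet> \<phi> (\<gamma> t) = 0"
      proof eventually_elim
        case (elim t)
        then have "\<phi> (\<gamma> t) \<in> S"
          using c(9) g(2) by blast
        then show ?case
          using n by (auto simp: orthogonal_comp_def real_inner_class.orthogonal_def inner_commute)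
      qed
      moreover have "((\<lambda>t. n \<bullet> \<phi> (\<gamma> t)) has_vector_derivative n \<bullet> A v) (at 0)"
        using d by (rule bounded_linear.has_vector_derivative[OF bounded_linear_inner_right])
      ultimately have "((\<lambda>t. 0) has_vector_derivative n \<bullet> A v) (at 0)"
        by (subst has_vector_derivative_cong_ev[of _ "\<lambda>t. n \<bullet> \<phi> (\<gamma> t)", symmetric])
          (auto dest: eventually_nhds_x_imp_x)
      then show ?thesis
        using vector_derivative_unique_at has_vector_derivative_const by blast
    qed
    then have "A v \<in> S\<^sup>\<bottom>\<^sup>\<bottom>"
      by (auto simp: orthogonal_comp_def real_inner_class.orthogonal_def)
    then show ?thesis
      using orthogonal_comp_self[OF c(7)] by simp
  qed
  have B_T: "B s \<in> tangent_space M x" if "s \<in> S" for s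
  proof -
    have "\<psi> (\<phi> x + t *\<^sub>R s) \<in> M" if "\<phi> x + t *\<^sub>R s \<in> V" for t
    proof -
      have "\<phi> x + t *\<^sub>R s \<in> \<phi> ` (U \<inter> M)"
        using c(7,9) x(2) \<open>s \<in> S\<close> that by (simp add: subspace_add subspace_scale)
      then show ?thesis
        using c(4) by (auto simp: homeomorphism_def)
    qed
    then have "curve_with_velocity M (\<psi> (\<phi> x)) (B s) (\<lambda>t. \<psi> (\<phi> x + t *\<^sub>R s))"
      unfolding B_def by (intro curve_with_velocity_along_line[of V]) (use c x in auto)
    then show ?thesis
      using x(3) by (auto simp: tangent_space_def)
  qed
  have "A ` tangent_space M x = S"
  proof (intro equalityI subsetI)
    show "s \<in> S" if "s \<in> A ` tangent_space M x" for s
      using that A_S by blast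
    show "s \<in> A ` tangent_space M x" if "s \<in> S" for s
      using B_T[OF that] AB[of s] by (metis image_eqI)
  qed
  moreover have "inj A"
    using BA by (metis injI)
  moreover have "linear A"
    using A by (rule has_derivative_linear)
  ultimately show ?thesis
    using c(8) dim_image_eq[of A "tangent_space M x"] by (metis inj_on_subset subset_UNIV)
qed


section \<open>Determinants of coordinate matrices\<close>

lemma representation_linear_combination:
  assumes "independent B" "\<And>j. j \<in> J \<Longrightarrow> v j \<in> span B"
  shows "representation B (\<Sum>j\<in>J. c j *\<^sub>R v j) b = (\<Sum>j\<in>J. c j * representation B (v j) b)"
  using assms by (simp add: real_vector.representation_sum real_vector.representation_scale span_scale)

lemma ordered_basis_length:
  fixes bs :: "'a::euclidean_space list"
  assumes "ordered_basis S bs"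
  shows "length bs = dim S"
  using assms unfolding ordered_basis_def
  by (metis distinct_card dim_span dim_eq_card_independent)

text \<open>A vector in the kernel of the matrix lists the coordinates of a vector in the kernel of the map.
  Equality of the dimensions makes the matrix square.\<close>

lemma det_matrix_wrt_nonzero:
  fixes A :: "'a::euclidean_space \<Rightarrow> 'b::euclidean_space"
  assumes bs: "ordered_basis S bs" and cs: "ordered_basis T cs" and "dim S = dim T"
    and A: "linear A" and AT: "A ` S \<subseteq> T" and inj: "inj_on A S"
  shows "Determinant.det (matrix_wrt bs cs A) \<noteq> 0"
proof
  define n where "n = length bs"
  have n: "length bs = n" "length cs = n"
    using ordered_basis_length[OF bs] ordered_basis_length[OF cs] \<open>dim S = dim T\<close>
    by (simp_all add: n_def)
  have ib: "independent (set bs)" "span (set bs) = S" "distinct bs"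
    and ic: "independent (set cs)" "span (set cs) = T"
    using bs cs by (auto simp: ordered_basis_def)
  have bsS: "bs ! j \<in> S" if "j < n" for j
    using ib(2) span_superset nth_mem that n(1) by blast
  have carrier: "matrix_wrt bs cs A \<in> carrier_mat n n"
    by (simp add: matrix_wrt_def n)
  assume "Determinant.det (matrix_wrt bs cs A) = 0"
  then obtain c where c: "c \<in> carrier_vec n" "c \<noteq> 0\<^sub>v n" "matrix_wrt bs cs A *\<^sub>v c = 0\<^sub>v n"
    using det_0_iff_vec_prod_zero_field[OF carrier] by blast
  define w where "w = (\<Sum>j<n. vec_index c j *\<^sub>R bs ! j)"
  have wS: "w \<in> S"
    unfolding w_def ib(2)[symmetric] using bsS ib(2) by (intro span_sum span_scale) auto
  have Aw: "A w = (\<Sum>j<n. vec_index c j *\<^sub>R A (bs ! j))"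
    unfolding w_def by (simp add: linear_sum[OF A] linear_cmul[OF A])
  have "representation (set cs) (A w) b = 0" if "b \<in> set cs" for b
  proof -
    obtain i where i: "i < n" "b = cs ! i"
      using \<open>b \<in> set cs\<close> unfolding in_set_conv_nth n(2) by blast
    have "representation (set cs) (A w) b
        = (\<Sum>j<n. vec_index c j * representation (set cs) (A (bs ! j)) b)"
      unfolding Aw using bsS AT ic by (intro representation_linear_combination) auto
    also have "\<dots> = vec_index (matrix_wrt bs cs A *\<^sub>v c) i"
      using i(1) c(1) n
      by (simp add: matrix_wrt_def scalar_prod_def i(2) lessThan_atLeast0 mult.commute)
    also have "\<dots> = 0"
      using i(1) by (simp add: c(3))
    finally show ?thesis .
  qed
  moreover have "A w \<in> span (set cs)"
    using wS AT ic(2) by blast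
  ultimately have "A w = 0"
    using real_vector.sum_representation_eq[OF ic(1), of "A w" "set cs"] by simp
  moreover have "0 \<in> S"
    using span_zero[of "set bs"] ib(2) by simp
  ultimately have w0: "w = 0"
    using inj_onD[OF inj, of w 0] wS linear_0[OF A] by simp
  have "vec_index c k = 0" if "k < n" for k
  proof -
    have "representation (set bs) w (bs ! k)
        = (\<Sum>j<n. vec_index c j * representation (set bs) (bs ! j) (bs ! k))"
      unfolding w_def using bsS ib by (intro representation_linear_combination) auto
    also have "\<dots> = (\<Sum>j<n. if j = k then vec_index c j else 0)"
      using that n(1) ib(1,3)
      by (intro sum.cong refl) (auto simp: real_vector.representation_basis nth_eq_iff_index_eq)
    also have "\<dots> = vec_index c k"
      using that by simp
    finally show ?thesis
      by (simp add: w0 real_vector.representation_zero)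
  qed
  then have "c = 0\<^sub>v n"
    using c(1) by auto
  with c(2) show False ..
qed

lemma matrix_wrt_cong:
  assumes "ordered_basis S bs" "\<And>v. v \<in> S \<Longrightarrow> A v = B v"
  shows "matrix_wrt bs cs A = matrix_wrt bs cs B"
proof -
  have "bs ! j \<in> S" if "j < length bs" for j
    using assms(1) that nth_mem span_superset unfolding ordered_basis_def by blast
  then show ?thesis
    unfolding matrix_wrt_def by (intro eq_matI) (auto simp: assms(2))
qed


section \<open>Smooth nearest-point projections\<close>

text \<open>The geometry of \<open>M\<close> is read off from the derivative of its nearest-point projection on an open
  neighbourhood \<open>N\<close>: this derivative varies smoothly, so that objects on the tangent
  spaces extend to \<open>N\<close> without the use of charts.\<close>

locale smooth_nearest_point_projection =
  fixes M N :: "'a::euclidean_space set"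
  assumes closed_M: "closed M" and nonempty_M: "M \<noteq> {}" and open_N: "open N" and M_subset_N: "M \<subseteq> N"
    and smooth: "smooth_on (closest_point M) N"
begin

definition DP :: "'a \<Rightarrow> 'a \<Rightarrow> 'a" where
  "DP y = frechet_derivative (closest_point M) (at y)"

lemma projection_in_M [simp]: "closest_point M y \<in> M"
  using closed_M nonempty_M by (rule closest_point_in_set)

lemma has_derivative_DP: "y \<in> N \<Longrightarrow> (closest_point M has_derivative DP y) (at y)"
  unfolding DP_def frechet_derivative_works[symmetric] by (rule smooth_on_differentiable[OF smooth])

lemma linear_DP: "y \<in> N \<Longrightarrow> linear (DP y)"
  by (rule has_derivative_linear[OF has_derivative_DP])

lemma Ck_on_1_DP: "Ck_on 1 (\<lambda>y. DP y u) N"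
  unfolding DP_def by (intro smooth_on_Ck_on_1 smooth_on_frechet_derivative smooth)

lemma DP_tangent:
  assumes "x \<in> M" "v \<in> tangent_space M x"
  shows "DP x v = v"
proof -
  have "(closest_point M has_derivative DP x) (at x)"
    using assms(1) M_subset_N by (intro has_derivative_DP) blast
  then have "differential M (\<lambda>y. y) x v = DP x v"
    by (rule differential_eq_extension) (simp_all add: closest_point_self assms(2))
  moreover have "differential M (\<lambda>y. y) x v = v"
    by (rule differential_eq_extension[OF has_derivative_ident]) (simp_all add: assms(2))
  ultimately show ?thesis
    by simp
qed

lemma DP_in_tangent_space: "y \<in> N \<Longrightarrow> DP y u \<in> tangent_space M (closest_point M y)"
  using curve_with_velocity_along_line[OF open_N _ smooth projection_in_M]
  unfolding tangent_space_def DP_def by blast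

text \<open>The projection maps every line through \<open>x\<close> to a curve in \<open>M\<close>, and it fixes every curve
  in \<open>M\<close>, so its derivative maps into the tangent space and is the identity there.\<close>

lemma tangent_space_eq_range_DP:
  assumes "x \<in> M"
  shows "tangent_space M x = range (DP x)"
proof -
  have "DP x u \<in> tangent_space M x" for u
    using DP_in_tangent_space[of x u] closest_point_self[OF assms] assms M_subset_N by auto
  then show ?thesis
    using DP_tangent[OF assms] by (auto simp: image_iff) metis
qed

lemma subspace_tangent_space:
  assumes "x \<in> M"
  shows "subspace (tangent_space M x)"
proof -
  have "linear (DP x)"
    using assms M_subset_N by (intro linear_DP) blast
  then show ?thesis
    unfolding tangent_space_eq_range_DP[OF assms] by (rule linear_subspace_image) simp
qed

text \<open>The nearest point of \<open>y\<close> minimises the distance to \<open>y\<close> among all \<open>closest_point M w\<close>, so the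
  derivative in \<open>w\<close> of the squared distance vanishes there.\<close>

lemma projection_normal:
  assumes "y \<in> N"
  shows "(y - closest_point M y) \<bullet> DP (closest_point M y) h = 0"
proof -
  define z where "z = closest_point M y"
  have z: "z \<in> M" "z \<in> N"
    using M_subset_N by (auto simp: z_def)
  have zz: "closest_point M z = z"
    using z(1) by (rule closest_point_self)
  define \<phi> where "\<phi> w = (y - closest_point M w) \<bullet> (y - closest_point M w)" for w
  have d: "(\<phi> has_derivative (\<lambda>h. (y - z) \<bullet> (0 - DP z h) + (0 - DP z h) \<bullet> (y - z))) (at z)"
    unfolding \<phi>_def
    by (rule has_derivative_eq_rhs[OF has_derivative_inner])
      (rule derivative_intros has_derivative_DP z refl | simp add: zz)+
  have "\<phi> z \<le> \<phi> w" for w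
  proof -
    have "dist y z \<le> dist y (closest_point M w)"
      unfolding z_def by (rule closest_point_le[OF closed_M projection_in_M])
    then show ?thesis
      unfolding \<phi>_def zz by (simp add: dot_square_norm dist_norm)
  qed
  then have "(\<lambda>h. (y - z) \<bullet> (0 - DP z h) + (0 - DP z h) \<bullet> (y - z)) = (\<lambda>h. 0)"
    by (intro differential_zero_maxmin[OF z(2) open_N d]) blast
  then have "(y - z) \<bullet> (0 - DP z h) + (0 - DP z h) \<bullet> (y - z) = 0"
    by (rule fun_cong)
  then show ?thesis
    by (simp add: z_def inner_commute inner_diff_left inner_diff_right)
qed

text \<open>Differentiating the normality relation of the preceding lemma at a point of \<open>M\<close>, where the
  displacement vanishes, shows that the idempotent \<open>DP x\<close> is an orthogonal projection.\<close>

lemma DP_orthogonal: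
  assumes "x \<in> M"
  shows "(w - DP x w) \<bullet> DP x u = 0"
proof -
  have xN: "x \<in> N" and xx: "closest_point M x = x"
    using assms M_subset_N closest_point_self[OF assms] by auto
  define b where "b y = DP (closest_point M y) u" for y
  have "Ck_on 1 b N"
    unfolding b_def using M_subset_N projection_in_M
    by (intro Ck_on_1_compose[OF Ck_on_1_DP smooth_on_Ck_on_1[OF smooth]]) blast
  then obtain b' where b': "(b has_derivative b') (at x)"
    using Ck_on_1_has_derivative[OF _ xN] by blast
  have "((\<lambda>y. (y - closest_point M y) \<bullet> b y) has_derivative
      (\<lambda>w. (x - closest_point M x) \<bullet> b' w + (w - DP x w) \<bullet> b x)) (at x)"
    by (intro has_derivative_inner has_derivative_diff has_derivative_ident has_derivative_DP xN b')
  moreover have "((\<lambda>y. (y - closest_point M y) \<bullet> b y) has_derivative (\<lambda>w. 0)) (at x)"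
    by (rule has_derivative_transform_within_open[OF has_derivative_const open_N xN])
      (simp add: b_def projection_normal)
  ultimately have "(\<lambda>w. (x - closest_point M x) \<bullet> b' w + (w - DP x w) \<bullet> b x) = (\<lambda>w. 0)"
    by (rule has_derivative_unique)
  from fun_cong[OF this, of w] show ?thesis
    by (simp add: xx b_def)
qed

lemma norm_DP_le:
  assumes "x \<in> M"
  shows "norm (DP x w) \<le> norm w"
proof -
  have "DP x w \<bullet> DP x w = w \<bullet> DP x w"
    using DP_orthogonal[OF assms, of w w] by (simp add: inner_diff_left)
  then have "norm (DP x w) * norm (DP x w) \<le> norm w * norm (DP x w)"
    using norm_cauchy_schwarz[of w "DP x w"] by (simp add: dot_square_norm power2_eq_square)
  then show ?thesis
    by (cases "norm (DP x w) = 0") (simp_all add: mult_le_cancel_right)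
qed

lemma closest_point_tangent_space:
  assumes "x \<in> M"
  shows "closest_point (tangent_space M x) w = DP x w"
proof (rule closest_point_unique[symmetric])
  show "convex (tangent_space M x)" "closed (tangent_space M x)"
    using subspace_tangent_space[OF assms] by (simp_all add: subspace_imp_convex closed_subspace)
  show "DP x w \<in> tangent_space M x"
    by (simp add: tangent_space_eq_range_DP[OF assms])
  show "\<forall>z\<in>tangent_space M x. dist w (DP x w) \<le> dist w z"
  proof
    fix z assume "z \<in> tangent_space M x"
    then have "DP x z = z"
      using DP_tangent[OF assms] by blast
    then have "(w - DP x w) \<bullet> (DP x w - z) = 0"
      using DP_orthogonal[OF assms, of w w] DP_orthogonal[OF assms, of w z] by (simp add: inner_diff_right)
    then have "(norm (w - DP x w + (DP x w - z)))\<^sup>2 = (norm (w - DP x w))\<^sup>2 + (norm (DP x w - z))\<^sup>2"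
      by (intro norm_add_Pythagorean) (simp add: real_inner_class.orthogonal_def)
    then have "(norm (w - DP x w))\<^sup>2 \<le> (norm (w - z))\<^sup>2"
      by simp
    then show "dist w (DP x w) \<le> dist w z"
      by (simp add: dist_norm power2_le_iff_abs_le)
  qed
qed

lemma bounded_linear_compose_DP:
  assumes "x \<in> M" "(E has_derivative E') (at x)"
  shows "bounded_linear (\<lambda>w. E' (DP x w))"
  using assms(1) M_subset_N
  by (intro bounded_linear_compose[OF has_derivative_bounded_linear[OF assms(2)]]
      has_derivative_bounded_linear[OF has_derivative_DP]) blast

lemma norm_differential_le_onorm:
  assumes "x \<in> M" and E: "(E has_derivative E') (at x)" and ext: "\<And>y. y \<in> M \<Longrightarrow> E y = F y"
    and v: "v \<in> tangent_space M x"
  shows "norm (differential M F x v) \<le> onorm (\<lambda>w. E' (DP x w)) * norm v"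
proof -
  have "bounded_linear (\<lambda>w. E' (DP x w))"
    by (rule bounded_linear_compose_DP[OF assms(1) E])
  moreover have "differential M F x v = E' (DP x v)"
    using differential_eq_extension[OF E ext v] DP_tangent[OF assms(1) v] by simp
  ultimately show ?thesis
    using onorm by metis
qed

text \<open>Precomposing with the orthogonal projection extends a map on the tangent space to the whole
  space without changing its norm; operator norms on varying tangent spaces thus become operator
  norms on a fixed space.\<close>

lemma onorm_on_differential:
  assumes "x \<in> M" and E: "(E has_derivative E') (at x)" and ext: "\<And>y. y \<in> M \<Longrightarrow> E y = F y"
  shows "onorm_on (tangent_space M x) (differential M F x) = onorm (\<lambda>w. E' (DP x w))"
    (is "?s = ?K")
proof (rule antisym)
  have 0: "0 \<in> tangent_space M x"
    using subspace_tangent_space[OF assms(1)] by (rule subspace_0)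
  have le: "norm (differential M F x v) / norm v \<le> ?K" if "v \<in> tangent_space M x" for v
  proof (cases "v = 0")
    case True
    have "bounded_linear (\<lambda>w. E' (DP x w))"
      by (rule bounded_linear_compose_DP[OF assms(1) E])
    with True show ?thesis
      by (simp add: onorm_pos_le)
  next
    case False
    then show ?thesis
      using norm_differential_le_onorm[OF assms that] by (simp add: divide_le_eq)
  qed
  show "?s \<le> ?K"
    unfolding onorm_on_def using 0 le by (intro cSUP_least) auto
  have bdd: "bdd_above ((\<lambda>v. norm (differential M F x v) / norm v) ` tangent_space M x)"
    using le by (intro bdd_aboveI2)
  have upper: "norm (differential M F x v) / norm v \<le> ?s" if "v \<in> tangent_space M x" for v
    unfolding onorm_on_def by (rule cSUP_upper[OF that bdd])
  have "0 \<le> ?s"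
    using upper[OF 0] by simp
  show "?K \<le> ?s"
  proof (rule onorm_le)
    fix w
    have v: "DP x w \<in> tangent_space M x"
      by (simp add: tangent_space_eq_range_DP[OF assms(1)])
    have "norm (E' (DP x w)) \<le> ?s * norm (DP x w)"
    proof (cases "DP x w = 0")
      case True
      then show ?thesis
        using linear_0[OF has_derivative_linear[OF E]] by simp
    next
      case False
      then show ?thesis
        using upper[OF v] differential_eq_extension[OF E ext v] by (simp add: divide_le_eq)
    qed
    also have "\<dots> \<le> ?s * norm w"
      using norm_DP_le[OF assms(1)] \<open>0 \<le> ?s\<close> by (rule mult_left_mono)
    finally show "norm (E' (DP x w)) \<le> ?s * norm w" .
  qed
qed

lemma norm_differential_le:
  assumes "x \<in> M" "(E has_derivative E') (at x)" "\<And>y. y \<in> M \<Longrightarrow> E y = F y" "v \<in> tangent_space M x"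
  shows "norm (differential M F x v) \<le> onorm_on (tangent_space M x) (differential M F x) * norm v"
  using norm_differential_le_onorm[OF assms] onorm_on_differential[OF assms(1-3)] by simp

text \<open>Compactness together with this continuity makes the maximal operator norm an attained
  maximum, hence an upper bound.\<close>

lemma continuous_on_onorm_on_differential:
  assumes E: "Ck_on 1 E W" and "M \<subseteq> W" and ext: "\<And>y. y \<in> M \<Longrightarrow> E y = F y"
  shows "continuous_on M (\<lambda>x. onorm_on (tangent_space M x) (differential M F x))"
proof -
  define B where "B x = Blinfun (\<lambda>w. frechet_derivative E (at x) (DP x w))" for x
  have d: "(E has_derivative frechet_derivative E (at x)) (at x)" if "x \<in> M" for x
    using that \<open>M \<subseteq> W\<close> by (intro Ck_on_1_has_derivative[OF E]) blast
  have B: "blinfun_apply (B x) = (\<lambda>w. frechet_derivative E (at x) (DP x w))" if "x \<in> M" for x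
    unfolding B_def
    by (rule bounded_linear_Blinfun_apply[OF bounded_linear_compose_DP[OF that d[OF that]]])
  have "continuous_on M B"
  proof (rule continuous_on_blinfun_componentwise)
    fix b :: 'a
    have "continuous_on M (\<lambda>x. DP x b)"
      by (rule continuous_on_subset[OF Ck_on_1_continuous[OF Ck_on_1_DP] M_subset_N])
    then have "continuous_on M (\<lambda>x. frechet_derivative E (at x) (DP x b))"
      using \<open>M \<subseteq> W\<close> by (intro Ck_on_1_continuous_derivative_apply[OF E] continuous_on_id) auto
    then show "continuous_on M (\<lambda>x. blinfun_apply (B x) b)"
      by (rule continuous_on_eq) (simp add: B)
  qed
  then have "continuous_on M (\<lambda>x. norm (B x))"
    by (rule continuous_on_norm)
  then show ?thesis
    by (rule continuous_on_eq) (simp add: norm_blinfun.rep_eq B onorm_on_differential[OF _ d ext])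
qed

end

lemma gradient_eq_sum:
  fixes f :: "'a::euclidean_space \<Rightarrow> real"
  assumes "f differentiable (at x)"
  shows "gradient f x = (\<Sum>b\<in>Basis. frechet_derivative f (at x) b *\<^sub>R b)"
  unfolding gradient_def
proof (rule the_equality)
  have d: "(f has_derivative frechet_derivative f (at x)) (at x)"
    using assms by (simp add: frechet_derivative_works)
  have eq: "frechet_derivative f (at x) h = h \<bullet> (\<Sum>b\<in>Basis. frechet_derivative f (at x) b *\<^sub>R b)" for h
    by (subst linear_eq_sum_Basis[OF has_derivative_linear[OF d]])
      (simp add: inner_sum_right mult.commute)
  show "GDERIV f x :> (\<Sum>b\<in>Basis. frechet_derivative f (at x) b *\<^sub>R b)"
    unfolding gderiv_def by (rule has_derivative_eq_rhs[OF d ext[OF eq]])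
  fix D
  assume "GDERIV f x :> D"
  then have "frechet_derivative f (at x) b = b \<bullet> D" for b
    using frechet_derivative_at unfolding gderiv_def by metis
  then show "D = (\<Sum>b\<in>Basis. frechet_derivative f (at x) b *\<^sub>R b)"
    by (simp add: inner_commute[of _ D] euclidean_representation)
qed

context smooth_nearest_point_projection
begin

text \<open>Since \<open>DP x\<close> is the orthogonal projection onto the tangent space at \<open>x\<close>, applying \<open>DP y\<close> to the
  Euclidean gradient at \<open>y\<close> extends the Riemannian gradient; expanding in the standard basis shows
  this extension to be a sum of products of functions of class C-1.\<close>

lemma riemannian_gradient_extension:
  assumes "M \<subseteq> U" and f: "Ck_on 2 f U"
  shows "\<exists>E. Ck_on 1 E (U \<inter> N) \<and> (\<forall>x\<in>M. E x = riemannian_gradient M f x)"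
proof (intro exI conjI ballI)
  let ?E = "\<lambda>y. \<Sum>b\<in>Basis. frechet_derivative f (at y) b *\<^sub>R DP y b"
  have f': "\<forall>x\<in>U. f differentiable (at x)" "Ck_on 1 (\<lambda>x. frechet_derivative f (at x) b) U" for b
    using f unfolding numeral_2_eq_2 One_nat_def Ck_on.simps(2)[of "Suc 0"] by blast+
  show "Ck_on 1 ?E (U \<inter> N)"
    by (intro Ck_on_1_sum Ck_on_1_scaleR Ck_on_subset[OF f'(2)] Ck_on_subset[OF Ck_on_1_DP]) auto
  fix x assume x: "x \<in> M"
  then have "linear (DP x)"
    using M_subset_N linear_DP by blast
  moreover have "gradient f x = (\<Sum>b\<in>Basis. frechet_derivative f (at x) b *\<^sub>R b)"
    using f'(1) x \<open>M \<subseteq> U\<close> by (intro gradient_eq_sum) blast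
  ultimately show "?E x = riemannian_gradient M f x"
    unfolding riemannian_gradient_def closest_point_tangent_space[OF x]
    by (simp add: linear_sum[of "DP x"] linear_cmul[of "DP x"])
qed

lemma retraction_deriv_eq_DP:
  assumes "x + u \<in> N"
  shows "retraction_deriv M x u = DP (x + u)"
proof -
  have "((\<lambda>v. x + v) has_derivative (\<lambda>h. h)) (at u)"
    by (auto intro!: derivative_eq_intros)
  from has_derivative_compose[OF this has_derivative_DP[OF assms]]
  have "((\<lambda>v. closest_point M (x + v)) has_derivative DP (x + u)) (at u)" .
  then show ?thesis
    unfolding retraction_deriv_def proj_retraction_def[abs_def]
    by (rule frechet_derivative_at[symmetric])
qed

text \<open>A tangent vector \<open>v\<close> is fixed by \<open>DP x\<close>.  If \<open>DP y\<close> kills the perturbed vector \<open>v - w\<close>, then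
  \<open>v = DP x w - (DP y - DP x) (v - w)\<close>, whose norm is at most \<open>k + (1 + k) / 3 < 1\<close> times that
  of \<open>v\<close>.\<close>

lemma perturbed_projection_injective:
  assumes "x \<in> M" "y \<in> N" and v: "v \<in> tangent_space M x"
    and close: "onorm (\<lambda>h. DP y h - DP x h) \<le> 1 / 3"
    and w: "norm w \<le> k * norm v" and "k < 1 / 2" and ker: "DP y (v - w) = 0"
  shows "v = 0"
proof (rule ccontr)
  assume "v \<noteq> 0"
  have k: "k * norm v < 1 / 2 * norm v"
    by (rule mult_strict_right_mono[OF \<open>k < 1 / 2\<close>]) (simp add: \<open>v \<noteq> 0\<close>)
  have xN: "x \<in> N"
    using \<open>x \<in> M\<close> M_subset_N by blast
  have "DP x w + DP x (v - w) = DP x v"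
    by (simp add: linear_add[OF linear_DP[OF xN], symmetric])
  then have "v = DP x w - (DP y (v - w) - DP x (v - w))"
    by (simp add: ker DP_tangent[OF \<open>x \<in> M\<close> v])
  then have "norm v \<le> norm (DP x w) + norm (DP y (v - w) - DP x (v - w))"
    by (metis norm_triangle_ineq4)
  also have "\<dots> \<le> norm w + 1 / 3 * norm (v - w)"
  proof (rule add_mono[OF norm_DP_le[OF \<open>x \<in> M\<close>]])
    have "bounded_linear (\<lambda>h. DP y h - DP x h)"
      by (intro bounded_linear_sub has_derivative_bounded_linear[OF has_derivative_DP] xN \<open>y \<in> N\<close>)
    then have "norm (DP y (v - w) - DP x (v - w)) \<le> onorm (\<lambda>h. DP y h - DP x h) * norm (v - w)"
      by (rule onorm)
    also have "\<dots> \<le> 1 / 3 * norm (v - w)"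
      using close by (rule mult_right_mono) simp
    finally show "norm (DP y (v - w) - DP x (v - w)) \<le> 1 / 3 * norm (v - w)" .
  qed
  also have "\<dots> \<le> 4 / 3 * norm w + 1 / 3 * norm v"
    using norm_triangle_ineq4[of v w] by simp
  also have "\<dots> < norm v"
    using w k by linarith
  finally show False
    by simp
qed

lemma projected_step_Ck_on_1:
  fixes \<alpha> :: real
  assumes "open W" and E: "Ck_on 1 E W"
  defines "W' \<equiv> W \<inter> (\<lambda>y. y - \<alpha> *\<^sub>R E y) -` N"
  shows "open W'" "Ck_on 1 (\<lambda>y. closest_point M (y - \<alpha> *\<^sub>R E y)) W'"
    and "x \<in> W' \<Longrightarrow> ((\<lambda>y. closest_point M (y - \<alpha> *\<^sub>R E y)) has_derivative
      (\<lambda>v. DP (x - \<alpha> *\<^sub>R E x) (v - \<alpha> *\<^sub>R frechet_derivative E (at x) v))) (at x)"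
proof -
  note step = Ck_on_1_diff_scaleR[OF E, of \<alpha>]
  show "open W'"
    unfolding W'_def
    by (rule continuous_open_preimage[OF Ck_on_1_continuous[OF step] \<open>open W\<close> open_N])
  show "Ck_on 1 (\<lambda>y. closest_point M (y - \<alpha> *\<^sub>R E y)) W'"
    by (rule Ck_on_1_compose[OF smooth_on_Ck_on_1[OF smooth] Ck_on_subset[OF step]])
      (auto simp: W'_def)
  assume x: "x \<in> W'"
  have "((\<lambda>y. y - \<alpha> *\<^sub>R E y) has_derivative (\<lambda>v. v - \<alpha> *\<^sub>R frechet_derivative E (at x) v)) (at x)"
    using x by (intro derivative_intros Ck_on_1_has_derivative[OF E]) (simp add: W'_def)
  then show "((\<lambda>y. closest_point M (y - \<alpha> *\<^sub>R E y)) has_derivative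
      (\<lambda>v. DP (x - \<alpha> *\<^sub>R E x) (v - \<alpha> *\<^sub>R frechet_derivative E (at x) v))) (at x)"
    by (rule has_derivative_compose[OF _ has_derivative_DP]) (use x in \<open>simp add: W'_def\<close>)
qed

end


section \<open>Riemannian gradient descent is an immersion\<close>

lemma le_Greatest_image:
  fixes \<phi> :: "'a::topological_space \<Rightarrow> real"
  assumes "compact K" "continuous_on K \<phi>" "x \<in> K"
  shows "\<phi> x \<le> (GREATEST h. h \<in> \<phi> ` K)"
proof -
  obtain y where y: "y \<in> K" "\<forall>z\<in>K. \<phi> z \<le> \<phi> y"
    using continuous_attains_sup[OF assms(1) _ assms(2)] assms(3) by blast
  have "(GREATEST h. h \<in> \<phi> ` K) = \<phi> y"
    by (rule Greatest_equality) (use y in auto)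
  with y assms(3) show ?thesis
    by simp
qed

text \<open>For \<open>c = 0\<close> the quotient is infinite and the conclusion holds because \<open>b\<close> is positive.\<close>

lemma ereal_less_divideD:
  assumes "ereal a < ereal b / ereal c" "0 \<le> c" "0 < b"
  shows "a * c < b"
  using assms by (cases "c = 0") (auto simp: pos_less_divide_eq)

theorem theorem2:
  fixes M U :: "(real ^ 'n) set" and f :: "real ^ 'n \<Rightarrow> real"
    and d :: nat and r L H G \<alpha> :: real
  assumes "compact M" and "smooth_submanifold d M"
    and "open U" and "M \<subseteq> U" and "Ck_on 2 f U"
    and "r > 0"
    and "\<forall>y\<in>tube M r. single_valued_projection M y"
    and "smooth_on (closest_point M) (tube M r)"
    and "L > 0" and "retraction_L_smooth M r L"
    and "H = (GREATEST h. h \<in> (\<lambda>x. onorm_on (tangent_space M x)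
                                 (differential M (riemannian_gradient M f) x)) ` M)"
    and "G = (GREATEST h. h \<in> (\<lambda>x. norm (riemannian_gradient M f x)) ` M)"
    and "\<alpha> > 0"
    and "ereal \<alpha> < min (1 / ereal (2 * H)) (min (1 / ereal (3 * L * G)) (ereal r / ereal G))"
  shows "immersion M M (rgd_map M f \<alpha>) \<and>
    (\<forall>x\<in>M. \<forall>bs cs.
       ordered_basis (tangent_space M x) bs \<longrightarrow>
       ordered_basis (tangent_space M (rgd_map M f \<alpha> x)) cs \<longrightarrow>
       Determinant.det (matrix_wrt bs cs (differential M (rgd_map M f \<alpha>) x)) \<noteq> 0)"
proof (cases "M = {}")
  case True
  then show ?thesis
    by (simp add: immersion_def Ck_map_def)
next
  case False
  let ?T = "tangent_space M" and ?g = "rgd_map M f \<alpha>" and ?grad = "riemannian_gradient M f"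
  have "open (tube M r)"
    unfolding tube_def by (intro open_Collect_less continuous_intros)
  moreover have "M \<subseteq> tube M r"
    using \<open>r > 0\<close> by (auto simp: tube_def)
  ultimately interpret smooth_nearest_point_projection M "tube M r"
    using False \<open>compact M\<close> assms(8) by unfold_locales (auto simp: compact_imp_closed)
  obtain E where E: "Ck_on 1 E (U \<inter> tube M r)" and ext: "\<And>x. x \<in> M \<Longrightarrow> E x = ?grad x"
    using riemannian_gradient_extension[OF \<open>M \<subseteq> U\<close> \<open>Ck_on 2 f U\<close>] by blast
  have MW: "M \<subseteq> U \<inter> tube M r"
    using \<open>M \<subseteq> U\<close> M_subset_N by blast
  have H: "onorm_on (?T x) (differential M ?grad x) \<le> H" if "x \<in> M" for x
    unfolding assms(11)
    by (rule le_Greatest_image[OF \<open>compact M\<close> continuous_on_onorm_on_differential[OF E MW ext] that])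
  have "continuous_on M (\<lambda>x. norm (?grad x))"
    by (rule continuous_on_eq[OF continuous_on_norm[OF continuous_on_subset[OF Ck_on_1_continuous[OF E] MW]]])
      (simp add: ext)
  then have G: "norm (?grad x) \<le> G" if "x \<in> M" for x
    unfolding assms(12) by (rule le_Greatest_image[OF \<open>compact M\<close> _ that])
  obtain x0 where x0: "x0 \<in> M"
    using False by blast
  \<comment> \<open>Nonnegativity of \<open>G\<close> and \<open>H\<close> allows the step-size bound to be multiplied out.\<close>
  have "0 \<le> G"
    using G[OF x0] norm_ge_zero order_trans by blast
  have "(E has_derivative frechet_derivative E (at x0)) (at x0)"
    using x0 MW by (intro Ck_on_1_has_derivative[OF E]) blast
  from onorm_on_differential[OF x0 this ext] bounded_linear_compose_DP[OF x0 this]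
  have "0 \<le> H"
    using H[OF x0] by (metis onorm_pos_le order_trans)
  have \<alpha>: "\<alpha> * (2 * H) < 1" "\<alpha> * (3 * L * G) < 1" "\<alpha> * G < r"
    using assms(14) \<open>0 \<le> H\<close> \<open>0 \<le> G\<close> \<open>L > 0\<close> \<open>r > 0\<close>
    by (auto intro!: ereal_less_divideD simp: one_ereal_def simp del: ereal_divide)
  define W where "W = (U \<inter> tube M r) \<inter> (\<lambda>y. y - \<alpha> *\<^sub>R E y) -` tube M r"
  have grad_tangent: "?grad x \<in> ?T x" if "x \<in> M" for x
    unfolding riemannian_gradient_def closest_point_tangent_space[OF that]
    by (simp add: tangent_space_eq_range_DP[OF that])
  have short: "norm (\<alpha> *\<^sub>R ?grad x) \<le> \<alpha> * G" if "x \<in> M" for x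
    using G[OF that] \<open>\<alpha> > 0\<close> by (simp add: mult_left_mono)
  have step_in_tube: "x - \<alpha> *\<^sub>R ?grad x \<in> tube M r" if "x \<in> M" for x
  proof -
    have "infdist (x - \<alpha> *\<^sub>R ?grad x) M \<le> dist (x - \<alpha> *\<^sub>R ?grad x) x"
      using that by (rule infdist_le)
    also have "\<dots> < r"
      using short[OF that] \<alpha>(3) by (simp add: dist_norm)
    finally show ?thesis
      by (simp add: tube_def)
  qed
  note step = projected_step_Ck_on_1[OF open_Int[OF \<open>open U\<close> open_N] E, where \<alpha> = \<alpha>, folded W_def]
  have MW': "M \<subseteq> W"
    using MW step_in_tube by (auto simp: W_def ext)
  have g_ext: "closest_point M (y - \<alpha> *\<^sub>R E y) = ?g y" if "y \<in> M" for y
    by (simp add: rgd_map_def ext that)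
  have g_M: "?g x \<in> M" for x
    by (simp add: rgd_map_def)
  define D where "D x v = DP (x - \<alpha> *\<^sub>R E x) (v - \<alpha> *\<^sub>R frechet_derivative E (at x) v)" for x v
  have deriv: "((\<lambda>y. closest_point M (y - \<alpha> *\<^sub>R E y)) has_derivative D x) (at x)" if "x \<in> M" for x
    unfolding D_def by (rule step(3)) (use that MW' in blast)
  have diff: "differential M ?g x v = D x v" if "x \<in> M" "v \<in> ?T x" for x v
    by (rule differential_eq_extension[OF deriv[OF that(1)] g_ext that(2)])
  have linear_D: "linear (D x)" if "x \<in> M" for x
    by (rule has_derivative_linear[OF deriv[OF that]])
  have ker: "v = 0" if x: "x \<in> M" and v: "v \<in> ?T x" and "D x v = 0" for x v
  proof (rule perturbed_projection_injective[OF x _ v])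
    let ?u = "- (\<alpha> *\<^sub>R ?grad x)"
    \<comment> \<open>The retraction bound covers only tangential displacements shorter than \<open>r\<close>.\<close>
    have u: "?u \<in> ?T x" "norm ?u < r"
      using grad_tangent[OF x] subspace_tangent_space[OF x] short[OF x] \<alpha>(3)
      by (auto simp: subspace_neg subspace_scale)
    show y: "x + ?u \<in> tube M r"
      using step_in_tube[OF x] by simp
    have "onorm (\<lambda>w. retraction_deriv M x ?u w - retraction_deriv M x 0 w) \<le> L * norm ?u"
      using assms(10) x u unfolding retraction_L_smooth_def by blast
    also have "\<dots> \<le> L * (\<alpha> * G)"
      using short[OF x] \<open>L > 0\<close> by (intro mult_left_mono) auto
    also have "\<dots> \<le> 1 / 3"
      using \<alpha>(2) by (simp add: mult_ac)
    finally show "onorm (\<lambda>h. DP (x + ?u) h - DP x h) \<le> 1 / 3"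
      using y x M_subset_N by (simp add: retraction_deriv_eq_DP subset_iff)
    have "(E has_derivative frechet_derivative E (at x)) (at x)"
      using x MW by (intro Ck_on_1_has_derivative[OF E]) blast
    from norm_differential_le[OF x this ext v] differential_eq_extension[OF this ext v]
    have "norm (frechet_derivative E (at x) v) \<le> onorm_on (?T x) (differential M ?grad x) * norm v"
      by simp
    also have "\<dots> \<le> H * norm v"
      using H[OF x] by (rule mult_right_mono) simp
    finally show "norm (\<alpha> *\<^sub>R frechet_derivative E (at x) v) \<le> (\<alpha> * H) * norm v"
      using \<open>\<alpha> > 0\<close> by (simp add: mult.assoc mult_left_mono)
    show "\<alpha> * H < 1 / 2"
      using \<alpha>(1) by simp
    show "DP (x + ?u) (v - \<alpha> *\<^sub>R frechet_derivative E (at x) v) = 0"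
      using \<open>D x v = 0\<close> by (simp add: D_def ext[OF x])
  qed
  have inj: "inj_on (D x) (?T x)" if "x \<in> M" for x
  proof (rule inj_onI)
    fix v w assume vw: "v \<in> ?T x" "w \<in> ?T x" "D x v = D x w"
    then have "v - w \<in> ?T x" "D x (v - w) = 0"
      using subspace_tangent_space[OF that] linear_D[OF that] by (auto simp: subspace_diff linear_diff)
    then show "v = w"
      using ker[OF that, of "v - w"] by simp
  qed
  have "immersion M M ?g"
    unfolding immersion_def
  proof (intro conjI ballI)
    show "?g ` M \<subseteq> M"
      using g_M by blast
    show "Ck_map 1 M ?g"
      unfolding Ck_map_def using step(1,2) MW' g_ext by blast
    show "inj_on (differential M ?g x) (?T x)" if "x \<in> M" for x
      using inj[OF that] diff[OF that] by (simp cong: inj_on_cong)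
  qed
  moreover have "Determinant.det (matrix_wrt bs cs (differential M ?g x)) \<noteq> 0"
    if x: "x \<in> M" and bs: "ordered_basis (?T x) bs" and cs: "ordered_basis (?T (?g x)) cs" for x bs cs
  proof -
    have "dim (?T x) = dim (?T (?g x))"
      using dim_tangent_space_submanifold[OF assms(2)] x g_M by simp
    moreover have "D x ` ?T x \<subseteq> ?T (?g x)"
      using DP_in_tangent_space[OF step_in_tube[OF x]] by (auto simp: D_def ext[OF x] rgd_map_def)
    ultimately have "Determinant.det (matrix_wrt bs cs (D x)) \<noteq> 0"
      using det_matrix_wrt_nonzero[OF bs cs _ linear_D[OF x] _ inj[OF x]] by blast
    then show ?thesis
      using matrix_wrt_cong[OF bs diff[OF x]] by simp
  qed
  ultimately show ?thesis
    by blast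
qed

end
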